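(* Assume $f:H\to H$ admits a power series representation $$f(q) := g(\tilde q) := \sum_{n=-\infty}^{\infty} \tilde q^{\,n}\,a_n\qquad\text{for } R_1\le |\tilde q|\le R_2,$$ with each $a_n$ a quaternion constant, $\tilde q = q-q_0$ where $q_0$ is a constant quaternion, and $R_1,R_2>0$ some constants. Then $$\frac{\partial^R f(q)}{\partial q} = \frac12\Big[f'(q) + (\tilde q-\tilde q^* )^{-1}\big(g(\tilde q)-g(\tilde q^* )\big)\Big],$$ where $f'(q)$ is the derivative in the usual sense, i.e., $$f'(q):=\sum_{n=-\infty}^{\infty} n\,\tilde q^{\,n-1}a_n=\sum_{n=-\infty}^{\infty} n\,(q-q_0)^{n-1}a_n.$$
   Context: $H$ denotes the non-commutative real algebra of quaternions $q=q_a+q_bi+q_cj+q_dk$ ($q_a,q_b,q_c,q_d\in\mathbb{R}$), with conjugate $q^*=q_a-q_bi-q_cj-q_dk$ and $|q|^2=qq^*$. A function $f:H\to H$ is viewed as a function of the four real variables $q_a,q_b,q_c,q_d$, with quaternion-valued partial derivatives $\partial f/\partial q_a,\dots,\partial f/\partial q_d$. The right restricted HR derivative of $f$ with respect to $q$ is $$\frac{\partial^R f}{\partial q}:=\frac14\left(\frac{\partial f}{\partial q_a}-i\frac{\partial f}{\partial q_b}-j\frac{\partial f}{\partial q_c}-k\frac{\partial f}{\partial q_d}\right).$$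
   Formalization: The formula is asserted for R_1<|q̃|<R_2 (on the boundary the partial derivatives need not exist, as f is arbitrary outside) and for non-real q̃, i.e. q̃≠q̃*, since (q̃-q̃* )^{-1} is otherwise undefined. *)

theory Defs
  imports "HOL-Analysis.Analysis"
begin

datatype quat = Quat (qa: real) (qb: real) (qc: real) (qd: real)

lemma quat_eq_iff: "x = y \<longleftrightarrow> qa x = qa y \<and> qb x = qb y \<and> qc x = qc y \<and> qd x = qd y"
  by (cases x; cases y) auto

definition qi :: quat where "qi = Quat 0 1 0 0"
definition qj :: quat where "qj = Quat 0 0 1 0"
definition qk :: quat where "qk = Quat 0 0 0 1"

definition qcnj :: "quat \<Rightarrow> quat"
  where "qcnj x = Quat (qa x) (- qb x) (- qc x) (- qd x)"

instantiation quat :: real_vector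
begin

definition "0 = Quat 0 0 0 0"
definition "x + y = Quat (qa x + qa y) (qb x + qb y) (qc x + qc y) (qd x + qd y)"
definition "- x = Quat (- qa x) (- qb x) (- qc x) (- qd x)"
definition "x - y = Quat (qa x - qa y) (qb x - qb y) (qc x - qc y) (qd x - qd y)"
definition "r *\<^sub>R x = Quat (r * qa x) (r * qb x) (r * qc x) (r * qd x)"

instance
  by standard
    (auto simp: quat_eq_iff zero_quat_def plus_quat_def uminus_quat_def minus_quat_def
      scaleR_quat_def algebra_simps)

end

instantiation quat :: real_algebra_1
begin

definition "1 = Quat 1 0 0 0"
definition "x * y = Quat
  (qa x * qa y - qb x * qb y - qc x * qc y - qd x * qd y)
  (qa x * qb y + qb x * qa y + qc x * qd y - qd x * qc y)
  (qa x * qc y - qb x * qd y + qc x * qa y + qd x * qb y)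
  (qa x * qd y + qb x * qc y - qc x * qb y + qd x * qa y)"

instance
  by standard
    (auto simp: quat_eq_iff zero_quat_def one_quat_def plus_quat_def times_quat_def
      scaleR_quat_def algebra_simps)

end

lemma quat_unit_products:
  "qi * qi = - 1" "qj * qj = - 1" "qk * qk = - 1"
  "qi * qj = qk" "qj * qk = qi" "qk * qi = qj"
  "qj * qi = - qk" "qk * qj = - qi" "qi * qk = - qj"
  by (simp_all add: qi_def qj_def qk_def one_quat_def times_quat_def uminus_quat_def)

lemma quat_decompose:
  "x = of_real (qa x) + qb x *\<^sub>R qi + qc x *\<^sub>R qj + qd x *\<^sub>R qk"
  by (simp add: quat_eq_iff of_real_def qi_def qj_def qk_def one_quat_def plus_quat_def
      scaleR_quat_def)

instantiation quat :: real_inner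
begin

definition "inner x y = qa x * qa y + qb x * qb y + qc x * qc y + qd x * qd y"
definition "norm x = sqrt ((qa x)\<^sup>2 + (qb x)\<^sup>2 + (qc x)\<^sup>2 + (qd x)\<^sup>2)"
definition "sgn (x :: quat) = x /\<^sub>R norm x"
definition "dist (x :: quat) y = norm (x - y)"
definition [code del]:
  "(uniformity :: (quat \<times> quat) filter) = (INF e\<in>{0<..}. principal {(x, y). dist x y < e})"
definition [code del]:
  "open (U :: quat set) \<longleftrightarrow> (\<forall>x\<in>U. eventually (\<lambda>(x', y). x' = x \<longrightarrow> y \<in> U) uniformity)"

instance
proof
  fix x y z :: quat and r :: real and U :: "quat set"
  show "dist x y = norm (x - y)" by (rule dist_quat_def)
  show "sgn x = x /\<^sub>R norm x" by (rule sgn_quat_def)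
  show "uniformity = (INF e\<in>{0<..}. principal {(x, y :: quat). dist x y < e})"
    by (rule uniformity_quat_def)
  show "open U \<longleftrightarrow> (\<forall>x\<in>U. eventually (\<lambda>(x', y). x' = x \<longrightarrow> y \<in> U) uniformity)"
    by (rule open_quat_def)
  show "inner x y = inner y x" by (simp add: inner_quat_def mult.commute)
  show "inner (x + y) z = inner x z + inner y z"
    by (simp add: inner_quat_def plus_quat_def algebra_simps)
  show "inner (r *\<^sub>R x) y = r * inner x y"
    by (simp add: inner_quat_def scaleR_quat_def algebra_simps)
  show "0 \<le> inner x x" by (simp add: inner_quat_def)
  have nonneg: "0 \<le> (qb x)\<^sup>2 + (qc x)\<^sup>2 + (qd x)\<^sup>2" "0 \<le> (qc x)\<^sup>2 + (qd x)\<^sup>2" by simp_all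
  show "inner x x = 0 \<longleftrightarrow> x = 0"
    using nonneg
    by (auto simp: inner_quat_def quat_eq_iff zero_quat_def add_nonneg_eq_0_iff)
  show "norm x = sqrt (inner x x)"
    by (simp add: inner_quat_def norm_quat_def power2_eq_square)
qed

end

lemma quat_mult_qcnj: "x * qcnj x = of_real ((norm x)\<^sup>2)"
  by (simp add: quat_eq_iff of_real_def norm_quat_def qcnj_def times_quat_def scaleR_quat_def
      one_quat_def power2_eq_square algebra_simps)

instantiation quat :: real_normed_div_algebra
begin

definition "inverse x = qcnj x /\<^sub>R (norm x)\<^sup>2"
definition "x div (y :: quat) = x * inverse y"

instance
proof
  fix x y :: quat
  have sq: "(norm z)\<^sup>2 = (qa z)\<^sup>2 + (qb z)\<^sup>2 + (qc z)\<^sup>2 + (qd z)\<^sup>2" for z :: quat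
    by (simp add: norm_quat_def)
  have "(norm (x * y))\<^sup>2 = (norm x * norm y)\<^sup>2"
    unfolding power_mult_distrib sq times_quat_def
    by (simp add: power2_eq_square algebra_simps)
  then show "norm (x * y) = norm x * norm y"
    by (simp add: power2_eq_iff_nonneg)
  show "x div y = x * inverse y" by (rule divide_quat_def)
  show "inverse 0 = (0 :: quat)"
    by (simp add: inverse_quat_def)
  assume "x \<noteq> 0"
  then have nz: "(norm x)\<^sup>2 \<noteq> 0" by simp
  then show "x * inverse x = 1"
    by (simp add: inverse_quat_def quat_mult_qcnj of_real_def)
  have "qcnj x * x = of_real ((norm x)\<^sup>2)"
    by (simp add: quat_eq_iff of_real_def norm_quat_def qcnj_def times_quat_def scaleR_quat_def
        one_quat_def power2_eq_square algebra_simps)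
  with nz show "inverse x * x = 1"
    by (simp add: inverse_quat_def of_real_def)
qed

end

text \<open>
  With \<open>e\<close> ranging over \<open>1, qi, qj, qk\<close>, these are the partial derivatives with respect to the
  four real coordinates \<open>qa, qb, qc, qd\<close>.
\<close>

definition has_partial_derivative :: "quat \<Rightarrow> (quat \<Rightarrow> quat) \<Rightarrow> quat \<Rightarrow> bool"
  where "has_partial_derivative e f q \<longleftrightarrow> (\<lambda>t::real. f (q + t *\<^sub>R e)) differentiable (at 0)"

definition partial_derivative :: "quat \<Rightarrow> (quat \<Rightarrow> quat) \<Rightarrow> quat \<Rightarrow> quat"
  where "partial_derivative e f q = vector_derivative (\<lambda>t::real. f (q + t *\<^sub>R e)) (at 0)"

definition right_HR_derivative :: "(quat \<Rightarrow> quat) \<Rightarrow> quat \<Rightarrow> quat"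
  where "right_HR_derivative f q =
    (1/4) *\<^sub>R (partial_derivative 1 f q - qi * partial_derivative qi f q
      - qj * partial_derivative qj f q - qk * partial_derivative qk f q)"

text \<open>
  As usual for Laurent series, a series over all integers converges when the parts with
  nonnegative and with negative index both converge; absolute convergence is not required.
\<close>

definition bilateral_summable :: "(int \<Rightarrow> 'a::real_normed_vector) \<Rightarrow> bool"
  where "bilateral_summable u \<longleftrightarrow>
    summable (\<lambda>n. u (int n)) \<and> summable (\<lambda>n. u (- int (Suc n)))"

definition bilateral_suminf :: "(int \<Rightarrow> 'a::real_normed_vector) \<Rightarrow> 'a"
  where "bilateral_suminf u = (\<Sum>n. u (int n)) + (\<Sum>n. u (- int (Suc n)))"

end

theory Submission
  imports Defs
begin

text \<open>
  Right multiplication by a constant commutes with the operator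
  \<open>T \<mapsto> (T 1 - i T i - j T j - k T k) / 4\<close>, which turns the differential of a function into its
  right HR derivative. The theorem therefore reduces to the powers of \<open>x = q - q0\<close>, provided that
  the series may be differentiated term by term.

  Non-commutativity makes the differential of \<open>x^n\<close> the sum
  \<open>x^0 h x^(n-1) + x^1 h x^(n-2) + \<dots> + x^(n-1) h x^0\<close>. Splitting off its last summand gives the
  recursion \<open>D_(n+1)(h) = D_n(h) x + x^n h\<close>, and the point of this form is that the HR operator
  passes through both summands: the right factor \<open>x\<close> comes out, and on \<open>h \<mapsto> c h\<close> the operator takes
  the value \<open>Re c\<close>, since \<open>i c i + j c j + k c k = c - 4 Re c\<close>. The right HR derivatives \<open>L_n\<close> of the
  powers thus satisfy \<open>L_(n+1) = L_n x + Re (x^n)\<close>. The expression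
  \<open>(n x^(n-1) + (x - x*)^(-1) (x^n - x*^n)) / 2\<close> satisfies the same recursion because \<open>x\<close> and \<open>x*\<close>
  commute and \<open>x^n + x*^n = 2 Re (x^n)\<close>. Negative powers are powers of \<open>y = x^(-1)\<close>, whose
  differential is \<open>h \<mapsto> - y h y\<close>; the same recursion then solves them, by means of
  \<open>y - y* = y (x* - x) y*\<close>. These are the lemmas \<open>HR_operator_power\<close> and
  \<open>HR_operator_inverse_power\<close>.

  For the analytic part, both halves of the series have the form \<open>\<Sum> z(p)^n b_n\<close>, with
  \<open>z(p) = p - q0\<close> or \<open>z(p) = (p - q0)^(-1)\<close>. Convergence at one real point of each bounding sphere
  bounds the coefficients geometrically, so on a small ball around \<open>q\<close> the differentials of the
  terms are dominated by a convergent numerical series. Lemma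
  \<open>has_derivative_power_series_compose\<close> draws the conclusion.
\<close>

section \<open>Quaternions: completeness and conjugation\<close>

lemma abs_components_le_norm:
  "\<bar>qa x\<bar> \<le> norm x" "\<bar>qb x\<bar> \<le> norm x" "\<bar>qc x\<bar> \<le> norm x" "\<bar>qd x\<bar> \<le> norm x"
  unfolding norm_quat_def by (auto intro!: real_le_rsqrt)

lemma Cauchy_component:
  fixes c :: "quat \<Rightarrow> real"
  assumes "Cauchy X"
    and "\<And>x. \<bar>c x\<bar> \<le> norm x" and "\<And>x y. c (x - y) = c x - c y"
  shows "convergent (\<lambda>n. c (X n))"
proof -
  have "dist (c x) (c y) \<le> dist x y" for x y
    using assms(2)[of "x - y"] by (simp add: assms(3) dist_norm)
  then have "Cauchy (\<lambda>n. c (X n))"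
    using assms(1) unfolding Cauchy_def by (meson le_less_trans)
  then show ?thesis
    by (rule Cauchy_convergent)
qed

text \<open>Completeness gives sums to the differentiated series, whose convergence is not assumed.\<close>

instance quat :: banach
proof
  fix X :: "nat \<Rightarrow> quat"
  assume X: "Cauchy X"
  have "convergent (\<lambda>n. qa (X n))" "convergent (\<lambda>n. qb (X n))"
    "convergent (\<lambda>n. qc (X n))" "convergent (\<lambda>n. qd (X n))"
    by (rule Cauchy_component[OF X]; simp add: abs_components_le_norm minus_quat_def)+
  then obtain A B C D where "(\<lambda>n. qa (X n)) \<longlonglongrightarrow> A" "(\<lambda>n. qb (X n)) \<longlonglongrightarrow> B"
    "(\<lambda>n. qc (X n)) \<longlonglongrightarrow> C" "(\<lambda>n. qd (X n)) \<longlonglongrightarrow> D"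
    unfolding convergent_def by blast
  then have "(\<lambda>n. of_real (qa (X n)) + qb (X n) *\<^sub>R qi + qc (X n) *\<^sub>R qj + qd (X n) *\<^sub>R qk)
      \<longlonglongrightarrow> of_real A + B *\<^sub>R qi + C *\<^sub>R qj + D *\<^sub>R qk"
    by (intro tendsto_intros)
  then show "convergent X"
    unfolding quat_decompose[symmetric] by (rule convergentI)
qed

lemma qcnj_mult: "qcnj (x * y) = qcnj y * qcnj x"
  by (simp add: quat_eq_iff qcnj_def times_quat_def algebra_simps)

lemma qcnj_power: "qcnj (x ^ n) = qcnj x ^ n"
  by (induction n) (simp_all add: qcnj_mult power_commutes, simp add: qcnj_def one_quat_def)

lemma norm_qcnj: "norm (qcnj x) = norm x"
  by (simp add: norm_quat_def qcnj_def)

lemma qcnj_inverse: "qcnj (inverse x) = inverse (qcnj x)"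
  by (simp add: inverse_quat_def norm_qcnj) (simp add: qcnj_def scaleR_quat_def)

lemma qcnj_commutes: "x * qcnj x = qcnj x * x"
  by (simp add: quat_eq_iff qcnj_def times_quat_def algebra_simps)

lemma of_real_Re: "of_real (qa x) = (1/2) *\<^sub>R (x + qcnj x)"
  by (simp add: quat_eq_iff of_real_def one_quat_def qcnj_def plus_quat_def scaleR_quat_def)

section \<open>The differential of a power\<close>

text \<open>
  The map \<open>h \<mapsto> x^0 h x^(n-1) + \<dots> + x^(n-1) h x^0\<close>, built up by its last summand so that a factor \<open>x\<close>
  can be taken out on the right.
\<close>

primrec power_differential :: "'a::real_normed_algebra_1 \<Rightarrow> nat \<Rightarrow> 'a \<Rightarrow> 'a"
  where
    "power_differential x 0 h = 0"
  | "power_differential x (Suc n) h = power_differential x n h * x + x ^ n * h"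

lemma has_derivative_power_noncomm:
  fixes z :: "'a::real_normed_vector \<Rightarrow> 'b::real_normed_algebra_1"
  assumes "(z has_derivative z') (at x within S)"
  shows "((\<lambda>x. z x ^ n) has_derivative (\<lambda>h. power_differential (z x) n (z' h))) (at x within S)"
proof (induction n)
  case (Suc n)
  have "((\<lambda>x. z x ^ n * z x) has_derivative
      (\<lambda>h. z x ^ n * z' h + power_differential (z x) n (z' h) * z x)) (at x within S)"
    by (rule has_derivative_mult[OF Suc assms])
  then show ?case
    by (simp add: power_Suc2 add.commute del: power_Suc)
qed simp

lemma norm_power_differential_le:
  "norm (power_differential x n h) \<le> real n * norm x ^ (n - 1) * norm h"
proof (induction n)
  case (Suc n)
  have "norm (power_differential x (Suc n) h)
      \<le> norm (power_differential x n h) * norm x + norm x ^ n * norm h"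
    by (simp, intro norm_triangle_le add_mono norm_mult_ineq order_trans[OF norm_mult_ineq]
        mult_right_mono norm_power_ineq) simp
  also have "\<dots> \<le> (real n * norm x ^ (n - 1) * norm h) * norm x + norm x ^ n * norm h"
    by (intro add_mono mult_right_mono Suc) auto
  also have "\<dots> = real (Suc n) * norm x ^ (Suc n - 1) * norm h"
    by (cases n) (simp_all add: algebra_simps)
  finally show ?case .
qed simp

lemma power_differential_commuting:
  assumes "x * h = h * x"
  shows "power_differential x n h = of_nat n * x ^ (n - 1) * h"
proof (induction n)
  case (Suc n)
  have "power_differential x n h * x = of_nat n * x ^ n * h"
    using Suc assms by (cases n) (simp_all add: mult.assoc power_Suc2 flip: assms del: power_Suc)
  then show ?case
    by (simp add: algebra_simps)
qed simp

section \<open>The right HR derivative of a power\<close>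

definition HR_operator :: "(quat \<Rightarrow> quat) \<Rightarrow> quat"
  where "HR_operator T = (1/4) *\<^sub>R (T 1 - qi * T qi - qj * T qj - qk * T qk)"

lemma HR_operator_add: "HR_operator (\<lambda>h. T h + U h) = HR_operator T + HR_operator U"
  by (simp add: HR_operator_def algebra_simps)

lemma HR_operator_minus: "HR_operator (\<lambda>h. - T h) = - HR_operator T"
  by (simp add: HR_operator_def algebra_simps)

lemma HR_operator_mult_right: "HR_operator (\<lambda>h. T h * c) = HR_operator T * c"
  by (simp add: HR_operator_def algebra_simps)

lemma HR_operator_sums:
  assumes "\<And>h. (\<lambda>n. T n h) sums U h"
  shows "(\<lambda>n. HR_operator (T n)) sums HR_operator U"
  unfolding HR_operator_def by (intro sums_scaleR_right sums_diff sums_mult assms)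

text \<open>This is \<open>i c i + j c j + k c k = c - 4 Re c\<close>: the imaginary part of \<open>c\<close> cancels.\<close>

lemma HR_operator_mult_left: "HR_operator (\<lambda>h. c * h) = of_real (qa c)"
  by (simp add: HR_operator_def quat_eq_iff of_real_def qi_def qj_def qk_def one_quat_def
      minus_quat_def scaleR_quat_def times_quat_def)

lemma right_HR_derivative_eq_HR_operator:
  assumes "(f has_derivative T) (at q)"
  shows "has_partial_derivative e f q" "right_HR_derivative f q = HR_operator T"
proof -
  have line: "((\<lambda>t::real. f (q + t *\<^sub>R e)) has_derivative (\<lambda>t. T (t *\<^sub>R e))) (at 0)" for e
  proof -
    have "((\<lambda>t::real. q + t *\<^sub>R e) has_derivative (\<lambda>t. t *\<^sub>R e)) (at 0)"
      by (auto intro!: derivative_eq_intros)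
    from has_derivative_compose[OF this, of f T] show ?thesis
      using assms by simp
  qed
  then show "has_partial_derivative e f q"
    unfolding has_partial_derivative_def differentiable_def by blast
  have "T (t *\<^sub>R e) = t *\<^sub>R T e" for t e
    by (rule linear_scale[OF has_derivative_linear[OF assms]])
  with line have "partial_derivative e f q = T e" for e
    unfolding partial_derivative_def
    by (intro vector_derivative_at) (simp add: has_vector_derivative_def)
  then show "right_HR_derivative f q = HR_operator T"
    by (simp add: right_HR_derivative_def HR_operator_def)
qed

text \<open>
  Induction with \<open>L_(n+1) = L_n x + Re (x^n)\<close>. Besides \<open>n x^(n-1)\<close>, the closed form contains the
  quotient \<open>(x - x*)^(-1) (x^n - x*^n)\<close>, which equals \<open>\<Sum> x^k x*^(n-1-k)\<close>: it grows by \<open>x*^n\<close> after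
  multiplication by \<open>x\<close>, just as \<open>n x^(n-1)\<close> grows by \<open>x^n\<close>, and the two increments add up to
  \<open>2 Re (x^n)\<close>.
\<close>

lemma HR_operator_power:
  assumes nonreal: "x \<noteq> qcnj x"
  shows "HR_operator (\<lambda>h. power_differential x n h) =
    (1/2) *\<^sub>R (of_nat n * x ^ (n - 1) + inverse (x - qcnj x) * (x ^ n - qcnj x ^ n))"
proof (induction n)
  case 0
  then show ?case
    by (simp add: HR_operator_def)
next
  case (Suc n)
  define d where "d = inverse (x - qcnj x)"
  have d: "d * (x - qcnj x) = 1"
    using nonreal by (simp add: d_def)
  have comm: "x * qcnj x ^ n = qcnj x ^ n * x"
    by (rule power_commuting_commutes[symmetric]) (rule qcnj_commutes[symmetric])
  have shift: "of_nat n * x ^ (n - 1) * x = of_nat n * x ^ n"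
    by (cases n) (simp_all add: mult.assoc power_commutes)
  have telescope: "d * (x ^ n - qcnj x ^ n) * x + qcnj x ^ n = d * (x ^ Suc n - qcnj x ^ Suc n)"
  proof -
    have "qcnj x ^ n = d * ((x - qcnj x) * qcnj x ^ n)"
      by (simp add: d flip: mult.assoc)
    then have "d * (x ^ n - qcnj x ^ n) * x + qcnj x ^ n
        = d * ((x ^ n - qcnj x ^ n) * x + (x - qcnj x) * qcnj x ^ n)"
      by (metis distrib_left mult.assoc)
    also have "(x ^ n - qcnj x ^ n) * x + (x - qcnj x) * qcnj x ^ n = x ^ Suc n - qcnj x ^ Suc n"
      by (simp add: algebra_simps comm power_commutes)
    finally show ?thesis .
  qed
  have "HR_operator (\<lambda>h. power_differential x (Suc n) h)
      = HR_operator (power_differential x n) * x + of_real (qa (x ^ n))"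
    by (simp add: HR_operator_add HR_operator_mult_right HR_operator_mult_left)
  also have "\<dots> = (1/2) *\<^sub>R (of_nat n * x ^ (n - 1) * x + x ^ n
      + (d * (x ^ n - qcnj x ^ n) * x + qcnj x ^ n))"
    by (simp add: Suc of_real_Re qcnj_power d_def distrib_right scaleR_add_right)
  finally show ?case
    unfolding telescope shift by (simp add: d_def distrib_right add.commute)
qed

text \<open>
  The chain rule inserts \<open>- y h y\<close> for \<open>h\<close>, so the recursion becomes
  \<open>L_(n+1) = L_n y - Re (y^(n+1)) y\<close>. After multiplication by \<open>y\<close> the difference quotient
  now grows by \<open>- y*^(n+1) y\<close>, which is the identity \<open>(x - x*) y* y = y* - y\<close> multiplied by \<open>y*^n\<close>.
\<close>

lemma HR_operator_inverse_power:
  assumes nonreal: "x \<noteq> qcnj x"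
  defines "y \<equiv> inverse x"
  shows "HR_operator (\<lambda>h. power_differential y n (- (y * h * y))) =
    (1/2) *\<^sub>R (- (of_nat n * y ^ Suc n) + inverse (x - qcnj x) * (y ^ n - qcnj y ^ n))"
proof (induction n)
  case 0
  then show ?case
    by (simp add: HR_operator_def)
next
  case (Suc n)
  define d where "d = inverse (x - qcnj x)"
  have d: "d * (x - qcnj x) = 1"
    using nonreal by (simp add: d_def)
  have "x \<noteq> 0"
    using nonreal by (auto simp: qcnj_def zero_quat_def)
  then have "qcnj x \<noteq> 0"
    by (metis norm_qcnj norm_eq_zero)
  have y: "y * x = 1" "x * y = 1" "qcnj y * qcnj x = 1" "qcnj x * qcnj y = 1"
    using \<open>x \<noteq> 0\<close> \<open>qcnj x \<noteq> 0\<close> by (simp_all add: y_def qcnj_inverse)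
  have resolvent: "(x - qcnj x) * qcnj y * y = qcnj y - y"
  proof -
    have "x * qcnj y = qcnj y * x"
      using y qcnj_commutes[of x] by (metis mult.assoc mult_1_left mult_1_right)
    then show ?thesis
      by (simp add: left_diff_distrib y) (simp add: mult.assoc y)
  qed
  have comm: "qcnj y * y = y * qcnj y"
    by (simp add: qcnj_commutes)
  have commn: "qcnj y ^ n * y = y * qcnj y ^ n"
    by (rule power_commuting_commutes) (rule comm)
  have telescope: "d * (y ^ n - qcnj y ^ n) * y - qcnj y ^ Suc n * y
      = d * (y ^ Suc n - qcnj y ^ Suc n)"
  proof -
    have "qcnj y ^ Suc n * y = (qcnj y * y) * qcnj y ^ n"
      by (simp add: mult.assoc commn)
    also have "\<dots> = d * ((x - qcnj x) * qcnj y * y * qcnj y ^ n)"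
      by (metis d mult.assoc mult_1_left)
    also have "\<dots> = d * ((qcnj y - y) * qcnj y ^ n)"
      by (simp add: resolvent)
    finally have "d * (y ^ n - qcnj y ^ n) * y - qcnj y ^ Suc n * y
        = d * ((y ^ n - qcnj y ^ n) * y - (qcnj y - y) * qcnj y ^ n)"
      by (simp only: right_diff_distrib left_diff_distrib mult.assoc)
    also have "(y ^ n - qcnj y ^ n) * y - (qcnj y - y) * qcnj y ^ n = y ^ Suc n - qcnj y ^ Suc n"
      by (simp add: algebra_simps commn power_commutes)
    finally show ?thesis .
  qed
  have "HR_operator (\<lambda>h. power_differential y (Suc n) (- (y * h * y)))
      = HR_operator (\<lambda>h. power_differential y n (- (y * h * y)) * y - y ^ Suc n * h * y)"
    by (simp add: power_Suc2 mult.assoc del: power_Suc)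
  also have "\<dots> = HR_operator (\<lambda>h. power_differential y n (- (y * h * y))) * y
      - of_real (qa (y ^ Suc n)) * y"
    using HR_operator_add[of "\<lambda>h. power_differential y n (- (y * h * y)) * y"
        "\<lambda>h. - (y ^ Suc n * h * y)"]
    by (simp only: HR_operator_minus HR_operator_mult_right HR_operator_mult_left
        diff_conv_add_uminus)
  also have "\<dots> = (1/2) *\<^sub>R (- (of_nat n * y ^ Suc n * y) - y ^ Suc n * y
      + (d * (y ^ n - qcnj y ^ n) * y - qcnj y ^ Suc n * y))"
    unfolding Suc of_real_Re qcnj_power d_def
    by (simp only: algebra_simps mult_scaleR_left mult_minus_left)
  finally show ?case
    unfolding telescope
    by (simp add: d_def algebra_simps power_commutes)
qed

section \<open>Termwise differentiation\<close>

text \<open>A Weierstrass test for the operator norms of the differentials.\<close>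

lemma has_derivative_suminf_dominated:
  fixes f :: "nat \<Rightarrow> 'a::real_normed_vector \<Rightarrow> 'b::banach"
  assumes S: "convex S" "open S" "x \<in> S"
    and deriv: "\<And>n x. x \<in> S \<Longrightarrow> (f n has_derivative f' n x) (at x)"
    and bound: "\<And>n x h. x \<in> S \<Longrightarrow> norm (f' n x h) \<le> M n * norm h"
    and M: "summable M"
    and conv: "summable (\<lambda>n. f n x)"
  shows "((\<lambda>x. \<Sum>n. f n x) has_derivative (\<lambda>h. \<Sum>n. f' n x h)) (at x)"
    and "summable (\<lambda>n. f' n x h)"
proof -
  have summable: "summable (\<lambda>n. f' n x h)" if "x \<in> S" for x h
    by (rule summable_comparison_test'[OF summable_mult2[OF M]]) (rule bound[OF that])
  then show "summable (\<lambda>n. f' n x h)"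
    using S by simp
  have uniform: "\<forall>\<^sub>F n in sequentially. \<forall>x\<in>S. \<forall>h.
      norm ((\<Sum>i<n. f' i x h) - (\<Sum>i. f' i x h)) \<le> e * norm h" if "e > 0" for e
  proof -
    obtain N where N: "\<And>n. n \<ge> N \<Longrightarrow> norm (\<Sum>i. M (i + n)) < e"
      using suminf_exist_split[OF \<open>e > 0\<close> M] by blast
    have "norm ((\<Sum>i<n. f' i x h) - (\<Sum>i. f' i x h)) \<le> e * norm h"
      if "n \<ge> N" "x \<in> S" for n x h
    proof -
      have M': "summable (\<lambda>i. M (i + n))"
        using M by (rule summable_ignore_initial_segment)
      have "norm ((\<Sum>i<n. f' i x h) - (\<Sum>i. f' i x h)) = norm (\<Sum>i. f' (i + n) x h)"
        by (simp add: suminf_minus_initial_segment[OF summable[OF \<open>x \<in> S\<close>]] norm_minus_commute)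
      also have "\<dots> \<le> (\<Sum>i. M (i + n) * norm h)"
        by (rule norm_suminf_le) (use \<open>x \<in> S\<close> bound M' in \<open>auto intro: summable_mult2\<close>)
      also have "\<dots> = (\<Sum>i. M (i + n)) * norm h"
        using suminf_mult2[OF M'] by simp
      also have "\<dots> \<le> e * norm h"
        using N[OF \<open>n \<ge> N\<close>] by (intro mult_right_mono) auto
      finally show ?thesis .
    qed
    then show ?thesis
      unfolding eventually_sequentially by blast
  qed
  have "\<exists>g. \<forall>x\<in>S. (\<lambda>n. f n x) sums g x
      \<and> (g has_derivative (\<lambda>h. \<Sum>n. f' n x h)) (at x within S)"
    by (rule has_derivative_series[where f = f and f' = f' and S = S and x = x,
          OF S(1) _ _ S(3) summable_sums[OF conv]])
      (auto intro: has_derivative_at_withinI deriv uniform)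
  then obtain g where g: "\<And>x. x \<in> S \<Longrightarrow> (\<lambda>n. f n x) sums g x"
    and g': "(g has_derivative (\<lambda>h. \<Sum>n. f' n x h)) (at x within S)"
    using S by blast
  have "(g has_derivative (\<lambda>h. \<Sum>n. f' n x h)) (at x)"
    using g' at_within_open[OF S(3,2)] by simp
  then show "((\<lambda>x. \<Sum>n. f n x) has_derivative (\<lambda>h. \<Sum>n. f' n x h)) (at x)"
    by (rule has_derivative_transform_within_open[OF _ S(2,3)]) (metis g sums_unique)
qed

text \<open>
  Only boundedness at \<open>K\<close> is available, not summability of the norms there, since the Laurent
  series need not converge absolutely on the bounding spheres.
\<close>

lemma summable_differentiated_majorant:
  fixes b :: "nat \<Rightarrow> 'a::real_normed_vector"
  assumes "0 \<le> r" "r < K" and bounded: "\<And>n. norm (b n) * K ^ n \<le> C"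
  shows "summable (\<lambda>n. real n * r ^ (n - 1) * norm (b n))"
proof -
  have "summable (\<lambda>n. diffs (\<lambda>n. norm (b n)) n * r ^ n)"
  proof (rule termdiff_converges)
    show "norm r < K"
      using assms by simp
    fix s :: real
    assume "norm s < K"
    then have "summable (\<lambda>n. norm (b n) * \<bar>s\<bar> ^ n)"
      by (intro Abel_lemma[OF _ _ bounded]) auto
    then have "summable (\<lambda>n. norm (norm (b n) * s ^ n))"
      by (simp add: abs_mult power_abs)
    then show "summable (\<lambda>n. norm (b n) * s ^ n)"
      by (rule summable_norm_cancel)
  qed
  then have "summable (\<lambda>n. real (Suc n) * r ^ (Suc n - 1) * norm (b (Suc n)))"
    by (simp add: diffs_def mult_ac)
  then show ?thesis
    by (subst (asm) summable_Suc_iff)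
qed

text \<open>
  The inner function \<open>z\<close> allows one statement to serve for the regular part of a Laurent series and,
  with an inverse for \<open>z\<close>, for its principal part.
\<close>

lemma has_derivative_power_series_compose:
  fixes z :: "'a::real_normed_vector \<Rightarrow> 'b::{real_normed_algebra_1,banach}"
  assumes S: "convex S" "open S" "x \<in> S"
    and deriv: "\<And>x. x \<in> S \<Longrightarrow> (z has_derivative z' x) (at x)"
    and z'_le: "\<And>x h. x \<in> S \<Longrightarrow> norm (z' x h) \<le> B * norm h"
    and z_le: "\<And>x. x \<in> S \<Longrightarrow> norm (z x) \<le> r"
    and "r < K" and bounded: "\<And>n. norm (b n) * K ^ n \<le> C"
    and conv: "summable (\<lambda>n. z x ^ n * b n)"
  shows "((\<lambda>x. \<Sum>n. z x ^ n * b n) has_derivative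
      (\<lambda>h. \<Sum>n. power_differential (z x) n (z' x h) * b n)) (at x)"
    and "summable (\<lambda>n. power_differential (z x) n (z' x h) * b n)"
proof -
  define M where "M n = B * (real n * r ^ (n - 1) * norm (b n))" for n
  have "0 \<le> r"
    using z_le[OF S(3)] norm_ge_zero order_trans by blast
  then have M: "summable M"
    unfolding M_def
    by (intro summable_mult summable_differentiated_majorant[OF _ \<open>r < K\<close> bounded])
  have bound: "norm (power_differential (z x) n (z' x h) * b n) \<le> M n * norm h"
    if "x \<in> S" for n x h
  proof -
    have "norm (power_differential (z x) n (z' x h) * b n)
        \<le> (real n * norm (z x) ^ (n - 1) * norm (z' x h)) * norm (b n)"
      by (intro order_trans[OF norm_mult_ineq] mult_right_mono norm_power_differential_le) simp
    also have "\<dots> \<le> (real n * r ^ (n - 1) * (B * norm h)) * norm (b n)"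
      using z_le[OF that] z'_le[OF that] \<open>0 \<le> r\<close>
      by (intro mult_right_mono mult_mono power_mono) auto
    finally show ?thesis
      by (simp add: M_def mult_ac)
  qed
  have deriv': "((\<lambda>x. z x ^ n * b n) has_derivative
      (\<lambda>h. power_differential (z x) n (z' x h) * b n)) (at x)" if "x \<in> S" for n x
    by (intro has_derivative_mult_left has_derivative_power_noncomm deriv that)
  show "((\<lambda>x. \<Sum>n. z x ^ n * b n) has_derivative
      (\<lambda>h. \<Sum>n. power_differential (z x) n (z' x h) * b n)) (at x)"
    by (rule has_derivative_suminf_dominated(1)[OF S deriv' bound M conv])
  show "summable (\<lambda>n. power_differential (z x) n (z' x h) * b n)"
    by (rule has_derivative_suminf_dominated(2)[OF S deriv' bound M conv])
qed

section \<open>Laurent series\<close>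

text \<open>
  The principal part, reindexed as a power series in \<open>inverse x\<close>. Its constant coefficient is \<open>0\<close>
  because the index \<open>0\<close> belongs to the regular part.
\<close>

definition principal_coeff :: "(int \<Rightarrow> 'a::zero) \<Rightarrow> nat \<Rightarrow> 'a"
  where "principal_coeff a n = (if n = 0 then 0 else a (- int n))"

lemma power_int_minus_Suc:
  fixes x :: "'a::division_ring"
  shows "x powi (- int (Suc n)) = inverse x ^ Suc n"
  by (simp add: power_int_def nat_add_distrib)

lemma bilateral_Laurent_sums:
  fixes x :: quat
  assumes "bilateral_summable (\<lambda>n. x powi n * a n)"
  shows "summable (\<lambda>n. x ^ n * a (int n))"
    and "summable (\<lambda>n. inverse x ^ n * principal_coeff a n)"
    and "bilateral_suminf (\<lambda>n. x powi n * a n) =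
      (\<Sum>n. x ^ n * a (int n)) + (\<Sum>n. inverse x ^ n * principal_coeff a n)"
proof -
  have eq: "x powi (- int (Suc n)) * a (- int (Suc n))
      = inverse x ^ Suc n * principal_coeff a (Suc n)" for n
    unfolding power_int_minus_Suc by (simp add: principal_coeff_def)
  show "summable (\<lambda>n. x ^ n * a (int n))"
    using assms by (simp add: bilateral_summable_def)
  have "summable (\<lambda>n. inverse x ^ Suc n * principal_coeff a (Suc n))"
    using assms unfolding bilateral_summable_def eq by blast
  then show S: "summable (\<lambda>n. inverse x ^ n * principal_coeff a n)"
    by (subst (asm) summable_Suc_iff)
  show "bilateral_suminf (\<lambda>n. x powi n * a n) =
      (\<Sum>n. x ^ n * a (int n)) + (\<Sum>n. inverse x ^ n * principal_coeff a n)"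
    unfolding bilateral_suminf_def eq using suminf_split_head[OF S]
    by (simp add: principal_coeff_def)
qed

lemma bilateral_derivative_sums:
  fixes x :: quat
  assumes "(\<lambda>n. of_nat n * x ^ (n - 1) * a (int n)) sums s"
    and "(\<lambda>n. of_nat n * inverse x ^ Suc n * principal_coeff a n) sums t"
  shows "bilateral_summable (\<lambda>n. of_int n * x powi (n - 1) * a n)"
    and "bilateral_suminf (\<lambda>n. of_int n * x powi (n - 1) * a n) = s - t"
proof -
  have regular: "of_int (int n) * x powi (int n - 1) * a (int n) = of_nat n * x ^ (n - 1) * a (int n)"
    for n
    by (cases n) simp_all
  have principal: "of_int (- int (Suc n)) * x powi (- int (Suc n) - 1) * a (- int (Suc n))
      = - (of_nat (Suc n) * inverse x ^ Suc (Suc n) * principal_coeff a (Suc n))" for n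
  proof -
    have "- int (Suc n) - 1 = - int (Suc (Suc n))"
      by simp
    then show ?thesis
      by (simp only: power_int_minus_Suc of_int_minus of_int_of_nat_eq mult_minus_left)
        (simp add: principal_coeff_def)
  qed
  have "(\<lambda>n. of_nat (Suc n) * inverse x ^ Suc (Suc n) * principal_coeff a (Suc n)) sums t"
    by (subst sums_Suc_iff) (use assms(2) in simp)
  then have "(\<lambda>n. - (of_nat (Suc n) * inverse x ^ Suc (Suc n) * principal_coeff a (Suc n))) sums (- t)"
    by (rule sums_minus)
  with assms(1) show "bilateral_summable (\<lambda>n. of_int n * x powi (n - 1) * a n)"
    and "bilateral_suminf (\<lambda>n. of_int n * x powi (n - 1) * a n) = s - t"
    unfolding bilateral_summable_def bilateral_suminf_def regular principal
    by (auto simp: sums_iff)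
qed

text \<open>
  The terms of a convergent series are bounded; at a point that is a real number their norms are
  the sought quantities.
\<close>

lemma coefficients_bounded:
  fixes b :: "nat \<Rightarrow> 'a::real_normed_div_algebra" and K :: real
  assumes "0 \<le> K" and "summable (\<lambda>n. of_real K ^ n * b n)"
  obtains C where "\<And>n. norm (b n) * K ^ n \<le> C"
proof -
  have "Bseq (\<lambda>n. of_real K ^ n * b n)"
    using assms(2) summable_imp_Bseq by blast
  then obtain C where "\<And>n. norm (of_real K ^ n * b n) \<le> C"
    unfolding Bseq_def by blast
  with that \<open>0 \<le> K\<close> show thesis
    by (auto simp: norm_mult norm_power mult.commute)
qed

theorem theorem3:
  fixes f g :: "quat \<Rightarrow> quat" and a :: "int \<Rightarrow> quat" and q0 q :: quat and R1 R2 :: real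
  assumes "R1 > 0" and "R2 > 0"
    and summable: "\<And>x. R1 \<le> norm x \<Longrightarrow> norm x \<le> R2 \<Longrightarrow>
      bilateral_summable (\<lambda>n. x powi n * a n)"
    and g: "\<And>x. R1 \<le> norm x \<Longrightarrow> norm x \<le> R2 \<Longrightarrow>
      g x = bilateral_suminf (\<lambda>n. x powi n * a n)"
    and f: "\<And>p. R1 \<le> norm (p - q0) \<Longrightarrow> norm (p - q0) \<le> R2 \<Longrightarrow> f p = g (p - q0)"
    and interior: "R1 < norm (q - q0)" "norm (q - q0) < R2"
    and nonreal: "q - q0 \<noteq> qcnj (q - q0)"
  shows "(\<forall>e\<in>{1, qi, qj, qk}. has_partial_derivative e f q) \<and>
    bilateral_summable (\<lambda>n. of_int n * (q - q0) powi (n - 1) * a n) \<and>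
    right_HR_derivative f q =
      (1/2) *\<^sub>R (bilateral_suminf (\<lambda>n. of_int n * (q - q0) powi (n - 1) * a n)
        + inverse ((q - q0) - qcnj (q - q0)) * (g (q - q0) - g (qcnj (q - q0))))"
proof -
  define x where "x = q - q0"
  define y where "y = inverse x"
  define d where "d = inverse (x - qcnj x)"
  define b c where "b n = a (int n)" and "c = principal_coeff a" for n
  have x: "R1 < norm x" "norm x < R2" "x \<noteq> qcnj x"
    using interior nonreal by (simp_all add: x_def)

  \<comment> \<open>Domination on \<open>S\<close> needs radii strictly between \<open>norm x\<close> and the bounding radii.\<close>
  define r1 r2 where "r1 = (R1 + norm x) / 2" and "r2 = (norm x + R2) / 2"
  have r: "R1 < r1" "r1 < norm x" "norm x < r2" "r2 < R2" "0 < r1"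
    using x \<open>R1 > 0\<close> by (simp_all add: r1_def r2_def)
  define S where "S = ball q (min (norm x - r1) (r2 - norm x))"
  have S: "convex S" "open S" "q \<in> S"
    using r by (simp_all add: S_def)
  have S_norm: "r1 < norm (p - q0)" "norm (p - q0) < r2" if "p \<in> S" for p
  proof -
    have "norm ((p - q0) - x) < min (norm x - r1) (r2 - norm x)"
      using that by (simp add: S_def x_def dist_norm norm_minus_commute)
    then show "r1 < norm (p - q0)" "norm (p - q0) < r2"
      using norm_triangle_ineq3[of "p - q0" x] by linarith+
  qed
  have S_annulus: "R1 \<le> norm (p - q0)" "norm (p - q0) \<le> R2" if "p \<in> S" for p
    using S_norm[OF that] r by linarith+

  note expand = bilateral_Laurent_sums[OF summable, folded b_def c_def]
  have g_sum: "g u = (\<Sum>n. u ^ n * b n) + (\<Sum>n. inverse u ^ n * c n)"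
    if "R1 \<le> norm u" "norm u \<le> R2" for u
    using g[OF that] expand(3)[OF that] by simp

  have "summable (\<lambda>n. of_real R2 ^ n * b n)"
    by (rule expand(1)) (use x \<open>R2 > 0\<close> in auto)
  then obtain C where C: "\<And>n. norm (b n) * R2 ^ n \<le> C"
    using coefficients_bounded[of R2 b] \<open>R2 > 0\<close> by auto
  have "summable (\<lambda>n. inverse (of_real R1) ^ n * c n)"
    by (rule expand(2)) (use x \<open>R1 > 0\<close> in auto)
  then obtain D where D: "\<And>n. norm (c n) * inverse R1 ^ n \<le> D"
    using coefficients_bounded[of "inverse R1" c] \<open>R1 > 0\<close> by auto

  define P where "P n h = power_differential x n h * b n" for n h
  define N where "N n h = power_differential y n (- (y * h * y)) * c n" for n h
  have regular: "((\<lambda>p. \<Sum>n. (p - q0) ^ n * b n) has_derivative (\<lambda>h. \<Sum>n. P n h)) (at q)"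
    "summable (\<lambda>n. P n h)" for h
    unfolding P_def x_def
    by (rule has_derivative_power_series_compose[OF S, where z = "\<lambda>p. p - q0" and z' = "\<lambda>p h. h"
            and B = 1 and r = r2, OF _ _ _ r(4) C expand(1)[OF S_annulus[OF S(3)]]];
        auto intro!: derivative_eq_intros intro: less_imp_le S_norm)+

  have inverse_le: "norm (inverse (p - q0)) \<le> inverse r1" if "p \<in> S" for p
    unfolding norm_inverse using S_norm[OF that] r by (intro le_imp_inverse_le) auto
  have inverse_deriv_le: "norm (- (inverse (p - q0) * h * inverse (p - q0)))
      \<le> (inverse r1 * inverse r1) * norm h" if "p \<in> S" for p h
  proof -
    have "norm (- (inverse (p - q0) * h * inverse (p - q0)))
        = norm (inverse (p - q0)) * norm (inverse (p - q0)) * norm h"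
      by (simp only: norm_minus_cancel norm_mult mult_ac)
    also have "\<dots> \<le> (inverse r1 * inverse r1) * norm h"
      using inverse_le[OF that] r by (intro mult_right_mono mult_mono) auto
    finally show ?thesis .
  qed
  have inverse_deriv: "((\<lambda>p. inverse (p - q0)) has_derivative
      (\<lambda>h. - (inverse (p - q0) * h * inverse (p - q0)))) (at p)" if "p \<in> S" for p
  proof (rule Deriv.has_derivative_inverse[where f = "\<lambda>p. p - q0" and f' = "\<lambda>h. h"])
    show "p - q0 \<noteq> 0"
      using S_norm(1)[OF that] r by auto
  qed (auto intro!: derivative_eq_intros)
  have r_inv: "inverse r1 < inverse R1"
    using r \<open>R1 > 0\<close> by simp
  have principal: "((\<lambda>p. \<Sum>n. inverse (p - q0) ^ n * c n) has_derivative (\<lambda>h. \<Sum>n. N n h)) (at q)"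
    "summable (\<lambda>n. N n h)" for h
    unfolding N_def y_def x_def
    by (rule has_derivative_power_series_compose[where z = "\<lambda>p. inverse (p - q0)"
            and z' = "\<lambda>p h. - (inverse (p - q0) * h * inverse (p - q0))",
          OF S _ _ _ r_inv D expand(2)[OF S_annulus[OF S(3)]]];
        fact inverse_deriv inverse_deriv_le inverse_le)+

  define T where "T h = (\<Sum>n. P n h) + (\<Sum>n. N n h)" for h
  have "((\<lambda>p. (\<Sum>n. (p - q0) ^ n * b n) + (\<Sum>n. inverse (p - q0) ^ n * c n))
      has_derivative T) (at q)"
    unfolding T_def by (intro has_derivative_add regular(1) principal(1))
  then have f_deriv: "(f has_derivative T) (at q)"
    by (rule has_derivative_transform_within_open[OF _ S(2,3)])
      (simp add: f g_sum S_annulus)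

  \<comment> \<open>The derived series are the termwise differentials in the direction \<open>1\<close>.\<close>
  have P_1: "P n 1 = of_nat n * x ^ (n - 1) * b n" for n
    by (simp add: P_def power_differential_commuting)
  have N_1: "N n 1 = - (of_nat n * y ^ Suc n * c n)" for n
  proof -
    have "power_differential y n (- (y * 1 * y)) = of_nat n * y ^ (n - 1) * - (y * y)"
      by (simp add: power_differential_commuting mult.assoc)
    also have "\<dots> = - (of_nat n * y ^ Suc n)"
      by (cases n) (simp_all add: mult.assoc power_Suc2 del: power_Suc)
    finally show ?thesis
      by (simp add: N_def)
  qed
  define s t where "s = (\<Sum>n. of_nat n * x ^ (n - 1) * b n)"
    and "t = (\<Sum>n. of_nat n * y ^ Suc n * c n)"
  have s: "(\<lambda>n. of_nat n * x ^ (n - 1) * b n) sums s"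
    using regular(2)[of 1] unfolding P_1 s_def by (rule summable_sums)
  have t: "(\<lambda>n. of_nat n * y ^ Suc n * c n) sums t"
    using principal(2)[of 1] unfolding N_1 t_def summable_minus_iff by (rule summable_sums)
  note f' = bilateral_derivative_sums[OF s[unfolded b_def] t[unfolded y_def c_def]]

  have annulus: "R1 \<le> norm x" "norm x \<le> R2" "R1 \<le> norm (qcnj x)" "norm (qcnj x) \<le> R2"
    using x by (simp_all add: norm_qcnj)
  have HR_P: "HR_operator (P n)
      = (1/2) *\<^sub>R (of_nat n * x ^ (n - 1) * b n + d * (x ^ n * b n - qcnj x ^ n * b n))" for n
    unfolding P_def HR_operator_mult_right HR_operator_power[OF x(3)] d_def
    by (simp add: algebra_simps)
  have HR_N: "HR_operator (N n)
      = (1/2) *\<^sub>R (- (of_nat n * y ^ Suc n * c n)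
          + d * (inverse x ^ n * c n - inverse (qcnj x) ^ n * c n))" for n
    unfolding N_def HR_operator_mult_right y_def HR_operator_inverse_power[OF x(3)] d_def
    by (simp only: algebra_simps qcnj_inverse mult_scaleR_left mult_minus_left)
  have "(\<lambda>n. HR_operator (P n)) sums HR_operator (\<lambda>h. \<Sum>n. P n h)"
    by (rule HR_operator_sums[OF summable_sums[OF regular(2)]])
  moreover have "(\<lambda>n. HR_operator (P n)) sums
      ((1/2) *\<^sub>R (s + d * ((\<Sum>n. x ^ n * b n) - (\<Sum>n. qcnj x ^ n * b n))))"
    unfolding HR_P
    by (intro sums_scaleR_right sums_add s sums_mult sums_diff summable_sums expand(1) annulus)
  ultimately have HR_regular: "HR_operator (\<lambda>h. \<Sum>n. P n h)
      = (1/2) *\<^sub>R (s + d * ((\<Sum>n. x ^ n * b n) - (\<Sum>n. qcnj x ^ n * b n)))"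
    by (rule sums_unique2)
  have "(\<lambda>n. HR_operator (N n)) sums HR_operator (\<lambda>h. \<Sum>n. N n h)"
    by (rule HR_operator_sums[OF summable_sums[OF principal(2)]])
  moreover have "(\<lambda>n. HR_operator (N n)) sums
      ((1/2) *\<^sub>R (- t + d * ((\<Sum>n. inverse x ^ n * c n) - (\<Sum>n. inverse (qcnj x) ^ n * c n))))"
    unfolding HR_N
    by (intro sums_scaleR_right sums_add sums_minus t sums_mult sums_diff summable_sums expand(2)
        annulus)
  ultimately have HR_principal: "HR_operator (\<lambda>h. \<Sum>n. N n h)
      = (1/2) *\<^sub>R (- t + d * ((\<Sum>n. inverse x ^ n * c n) - (\<Sum>n. inverse (qcnj x) ^ n * c n)))"
    by (rule sums_unique2)
  have "HR_operator T = (1/2) *\<^sub>R ((s - t) + d * (g x - g (qcnj x)))"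
    unfolding T_def HR_operator_add HR_regular HR_principal g_sum[OF annulus(1,2)]
      g_sum[OF annulus(3,4)]
    by (simp add: algebra_simps)
  with f' right_HR_derivative_eq_HR_operator[OF f_deriv] show ?thesis
    by (simp add: x_def d_def)
qed

end
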